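(* Let $\mathcal V_{W\dot W}$ be a genaut and let $\mathcal V_W$ be conditioned invariant in $\mathcal V_{W\dot W}$. Then 1. $\mathcal V_W\supseteq(\mathcal V_{W\dot W}\times\dot W)_W$. 2. If $\mathcal V_{W\dot W}$ is a USG, then $\mathcal V_{W\dot W}+(\mathcal V_W\oplus(\mathcal V_W)_{\dot W})$ is a genop.
   Context: Fix a field $\mathbb F$; all index sets are finite. A vector on $X$ is a function $X\to\mathbb F$. $W,\dot W$ are disjoint sets that are copies of each other (in bijection); subscripts such as $(\mathcal V_W)_{\dot W}$ denote transport along the bijection. A genaut $\mathcal V_{W\dot W}$ is a linear subspace of vectors $(f_W,g_{\dot W})$ on $W\uplus\dot W$. For disjoint $X,Y$: $\mathcal V_{XY}\circ X:=\{f_X:(f_X,g_Y)\in\mathcal V_{XY}\text{ for some }g_Y\}$, $\mathcal V_{XY}\times X:=\{f_X:(f_X,0_Y)\in\mathcal V_{XY}\}$, $\mathcal V_{XY}\leftrightarrow\mathcal V_Y:=\{f_X:\exists g_Y\in\mathcal V_Y,\ (f_X,g_Y)\in\mathcal V_{XY}\}$. $\mathcal V_X\oplus\mathcal V_Y:=\{(f_X,g_Y):f_X\in\mathcal V_X,g_Y\in\mathcal V_Y\}$. A genaut is a USG if $\mathcal V_{W\dot W}\circ W\supseteq(\mathcal V_{W\dot W}\circ\dot W)_W$; an LSG if $\mathcal V_{W\dot W}\times W\supseteq(\mathcal V_{W\dot W}\times\dot W)_W$; a genop if it is both a USG and an LSG. A subspace $\mathcal V_W$ is conditioned invariant in $\mathcal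 V_{W\dot W}$ iff $\mathcal V_{W\dot W}\leftrightarrow\mathcal V_W\subseteq(\mathcal V_W)_{\dot W}$. *)

theory Defs
  imports Complex_Main "HOL-Library.Function_Algebras" "HOL-Library.Set_Algebras"
begin

text \<open>A vector on an index set \<open>X\<close> is encoded as a function on the ambient type that vanishes
  outside \<open>X\<close>; addition of vectors and sums of sets of vectors are then the pointwise and
  elementwise ones of the library.\<close>

definition vectors_on :: "'i set \<Rightarrow> ('i \<Rightarrow> 'a::field) set" where
  "vectors_on X = {f. \<forall>i. i \<notin> X \<longrightarrow> f i = 0}"

definition vscale :: "'a::field \<Rightarrow> ('i \<Rightarrow> 'a) \<Rightarrow> 'i \<Rightarrow> 'a" where
  "vscale c f = (\<lambda>i. c * f i)"

global_interpretation vec: vector_space vscale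
  by unfold_locales (auto simp: vscale_def fun_eq_iff algebra_simps)

definition subspace_on :: "'i set \<Rightarrow> ('i \<Rightarrow> 'a::field) set \<Rightarrow> bool" where
  "subspace_on X V \<longleftrightarrow> V \<subseteq> vectors_on X \<and> vec.subspace V"

text \<open>\<open>join X Y f g\<close> is the vector \<open>(f\<^sub>X, g\<^sub>Y)\<close> on \<open>X \<union> Y\<close>; it is used for disjoint \<open>X\<close>, \<open>Y\<close> only,
  where \<open>join X Y f g = join Y X g f\<close>.\<close>

definition join :: "'i set \<Rightarrow> 'i set \<Rightarrow> ('i \<Rightarrow> 'a::field) \<Rightarrow> ('i \<Rightarrow> 'a) \<Rightarrow> 'i \<Rightarrow> 'a" where
  "join X Y f g = (\<lambda>i. if i \<in> X then f i else if i \<in> Y then g i else 0)"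

text \<open>For \<open>V\<close> on \<open>X \<union> Y\<close>, the following are \<open>V \<circ> X\<close>, \<open>V \<times> X\<close> and \<open>V \<leftrightarrow> U\<close> (with \<open>U\<close> on \<open>Y\<close>).\<close>

definition restriction :: "'i set \<Rightarrow> 'i set \<Rightarrow> ('i \<Rightarrow> 'a::field) set \<Rightarrow> ('i \<Rightarrow> 'a) set" where
  "restriction X Y V = {f \<in> vectors_on X. \<exists>g \<in> vectors_on Y. join X Y f g \<in> V}"

definition contraction :: "'i set \<Rightarrow> 'i set \<Rightarrow> ('i \<Rightarrow> 'a::field) set \<Rightarrow> ('i \<Rightarrow> 'a) set" where
  "contraction X Y V = {f \<in> vectors_on X. join X Y f 0 \<in> V}"

definition matched :: "'i set \<Rightarrow> 'i set \<Rightarrow> ('i \<Rightarrow> 'a::field) set \<Rightarrow> ('i \<Rightarrow> 'a) set \<Rightarrow> ('i \<Rightarrow> 'a) set" where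
  "matched X Y V U = {f \<in> vectors_on X. \<exists>g \<in> U. join X Y f g \<in> V}"

definition direct_sum :: "'i set \<Rightarrow> 'i set \<Rightarrow> ('i \<Rightarrow> 'a::field) set \<Rightarrow> ('i \<Rightarrow> 'a) set \<Rightarrow> ('i \<Rightarrow> 'a) set" where
  "direct_sum X Y U V = {join X Y f g | f g. f \<in> U \<and> g \<in> V}"

text \<open>Transport of a set of vectors on \<open>X\<close> to \<open>Y\<close> along a bijection \<open>b\<close> from \<open>X\<close> to \<open>Y\<close>.\<close>

definition transport :: "'i set \<Rightarrow> 'i set \<Rightarrow> ('i \<Rightarrow> 'i) \<Rightarrow> ('i \<Rightarrow> 'a::field) set \<Rightarrow> ('i \<Rightarrow> 'a) set" where
  "transport X Y b V = {g \<in> vectors_on Y. \<exists>f \<in> V. \<forall>x \<in> X. g (b x) = f x}"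

text \<open>Below, \<open>W'\<close> is the disjoint copy of \<open>W\<close>, and \<open>b\<close> is the bijection from \<open>W\<close> to \<open>W'\<close>.\<close>

definition genaut :: "'i set \<Rightarrow> 'i set \<Rightarrow> ('i \<Rightarrow> 'a::field) set \<Rightarrow> bool" where
  "genaut W W' V \<longleftrightarrow> subspace_on (W \<union> W') V"

definition USG :: "'i set \<Rightarrow> 'i set \<Rightarrow> ('i \<Rightarrow> 'i) \<Rightarrow> ('i \<Rightarrow> 'a::field) set \<Rightarrow> bool" where
  "USG W W' b V \<longleftrightarrow> genaut W W' V \<and>
     transport W' W (inv_into W b) (restriction W' W V) \<subseteq> restriction W W' V"

definition LSG :: "'i set \<Rightarrow> 'i set \<Rightarrow> ('i \<Rightarrow> 'i) \<Rightarrow> ('i \<Rightarrow> 'a::field) set \<Rightarrow> bool" where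
  "LSG W W' b V \<longleftrightarrow> genaut W W' V \<and>
     transport W' W (inv_into W b) (contraction W' W V) \<subseteq> contraction W W' V"

definition genop :: "'i set \<Rightarrow> 'i set \<Rightarrow> ('i \<Rightarrow> 'i) \<Rightarrow> ('i \<Rightarrow> 'a::field) set \<Rightarrow> bool" where
  "genop W W' b V \<longleftrightarrow> USG W W' b V \<and> LSG W W' b V"

definition conditioned_invariant ::
  "'i set \<Rightarrow> 'i set \<Rightarrow> ('i \<Rightarrow> 'i) \<Rightarrow> ('i \<Rightarrow> 'a::field) set \<Rightarrow> ('i \<Rightarrow> 'a) set \<Rightarrow> bool" where
  "conditioned_invariant W W' b V U \<longleftrightarrow>
     subspace_on W U \<and> matched W' W V U \<subseteq> transport W W' b U"

end

theory Submission imports Defs begin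

text \<open>The idea is to embed everything in the ambient space: a vector on \<open>X \<union> Y\<close> splits as the sum
  of its truncations to \<open>X\<close> and to \<open>Y\<close>. Then restriction is the image under truncation (a linear
  map), contraction is intersection with \<open>vectors_on X\<close>, and the direct sum is an elementwise sum,
  so that the space in question is \<open>V + (U + U')\<close>, where \<open>U'\<close> is the copy of \<open>U\<close> on \<open>W'\<close>.

  Conditioned invariance says: if \<open>v \<in> V\<close> has its \<open>W\<close>-part in \<open>U\<close>, then its \<open>W'\<close>-part is in \<open>U'\<close>.
  It follows that every vector \<open>v + (u + u')\<close> supported in \<open>W'\<close> lies in \<open>U'\<close>
  (\<open>contraction_extension_subset\<close>), so that its copy on \<open>W\<close> lies in \<open>U\<close>. As \<open>V\<close> is contained in
  \<open>V + (U + U')\<close>, this gives the first claim; as \<open>U\<close> is too, it gives the LSG property. The USG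
  property passes from \<open>V\<close> to the extension, because the restriction to \<open>W\<close> grows by \<open>U\<close> and the
  restriction to \<open>W'\<close> by its copy \<open>U'\<close> (\<open>restriction_extension\<close>).\<close>

definition truncate :: "'i set \<Rightarrow> ('i \<Rightarrow> 'a::field) \<Rightarrow> 'i \<Rightarrow> 'a" where
  "truncate X f = (\<lambda>i. if i \<in> X then f i else 0)"

lemma truncate_add: "truncate X (f + g) = truncate X f + truncate X g"
  by (auto simp: truncate_def fun_eq_iff)

lemma truncate_in_vectors_on [simp]: "truncate X f \<in> vectors_on X"
  by (auto simp: truncate_def vectors_on_def)

lemma truncate_id: "f \<in> vectors_on X \<Longrightarrow> truncate X f = f"
  by (auto simp: truncate_def vectors_on_def fun_eq_iff)

lemma truncate_zero: "f \<in> vectors_on Y \<Longrightarrow> X \<inter> Y = {} \<Longrightarrow> truncate X f = 0"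
  by (auto simp: truncate_def vectors_on_def fun_eq_iff)

lemma join_truncate: "f \<in> vectors_on (X \<union> Y) \<Longrightarrow> join X Y (truncate X f) (truncate Y f) = f"
  by (auto simp: truncate_def join_def vectors_on_def fun_eq_iff)

lemma truncate_join_left: "f \<in> vectors_on X \<Longrightarrow> truncate X (join X Y f g) = f"
  by (auto simp: truncate_def join_def vectors_on_def fun_eq_iff)

lemma join_eq_add:
  "X \<inter> Y = {} \<Longrightarrow> f \<in> vectors_on X \<Longrightarrow> g \<in> vectors_on Y \<Longrightarrow> join X Y f g = f + g"
  by (auto simp: join_def vectors_on_def fun_eq_iff)

lemma vectors_on_mono: "X \<subseteq> Y \<Longrightarrow> vectors_on X \<subseteq> vectors_on Y"
  by (auto simp: vectors_on_def)

lemma vec_subspace_vectors_on: "vec.subspace (vectors_on X)"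
  by (auto simp: vec.subspace_def vectors_on_def vscale_def)

lemma vec_subspace_set_plus: "vec.subspace A \<Longrightarrow> vec.subspace B \<Longrightarrow> vec.subspace (A + B)"
proof -
  assume "vec.subspace A" "vec.subspace B"
  then have "vec.subspace {x + y |x y. x \<in> A \<and> y \<in> B}"
    by (rule vec.subspace_sums)
  moreover have "A + B = {x + y |x y. x \<in> A \<and> y \<in> B}"
    by (auto simp: set_plus_def)
  ultimately show ?thesis by simp
qed

lemma subspace_on_set_plus:
  assumes "subspace_on X A" and "subspace_on X B"
  shows "subspace_on X (A + B)"
proof -
  have "A + B \<subseteq> vectors_on X"
    using assms vec.subspace_add[OF vec_subspace_vectors_on]
    by (fastforce simp: subspace_on_def elim!: set_plus_elim)
  then show ?thesis
    using assms vec_subspace_set_plus by (auto simp: subspace_on_def)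
qed

lemma restriction_eq:
  assumes "V \<subseteq> vectors_on (X \<union> Y)"
  shows "restriction X Y V = truncate X ` V"
proof
  show "restriction X Y V \<subseteq> truncate X ` V"
  proof
    fix f assume "f \<in> restriction X Y V"
    then obtain g where "f \<in> vectors_on X" "join X Y f g \<in> V"
      by (auto simp: restriction_def)
    then show "f \<in> truncate X ` V"
      by (metis truncate_join_left imageI)
  qed
  show "truncate X ` V \<subseteq> restriction X Y V"
  proof (rule image_subsetI)
    fix v assume "v \<in> V"
    then have "join X Y (truncate X v) (truncate Y v) \<in> V"
      using assms join_truncate[of v X Y] by auto
    then show "truncate X v \<in> restriction X Y V"
      by (auto simp: restriction_def intro: bexI[where x = "truncate Y v"])
  qed
qed

lemma contraction_eq: "contraction X Y V = V \<inter> vectors_on X"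
proof -
  have "join X Y f 0 = f" if "f \<in> vectors_on X" for f :: "'a \<Rightarrow> 'b"
    using that by (auto simp: join_def vectors_on_def fun_eq_iff)
  then show ?thesis by (auto simp: contraction_def)
qed

lemma truncate_in_matched:
  assumes "v \<in> V" and "v \<in> vectors_on (X \<union> Y)" and "truncate Y v \<in> U"
  shows "truncate X v \<in> matched X Y V U"
  unfolding matched_def using assms join_truncate[of v X Y] by (auto intro!: bexI[where x = "truncate Y v"])

lemma direct_sum_eq:
  assumes "X \<inter> Y = {}" and "A \<subseteq> vectors_on X" and "B \<subseteq> vectors_on Y"
  shows "direct_sum X Y A B = A + B"
  unfolding direct_sum_def set_plus_def
  using assms join_eq_add[of X Y] by (metis (no_types, lifting) subsetD)

lemma transport_subset_vectors_on: "transport X Y b V \<subseteq> vectors_on Y"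
  by (auto simp: transport_def)

text \<open>Eliminates \<open>inv_into\<close>: since \<open>b\<close> is a bijection, transport back along its inverse is governed
  by the same relation \<open>\<forall>x\<in>X. g (b x) = f x\<close> as transport along \<open>b\<close>.\<close>

lemma transport_inv_iff:
  assumes "bij_betw b X Y"
  shows "f \<in> transport Y X (inv_into X b) S \<longleftrightarrow>
    f \<in> vectors_on X \<and> (\<exists>g\<in>S. \<forall>x\<in>X. g (b x) = f x)"
proof -
  have "(\<forall>y\<in>Y. f (inv_into X b y) = g y) \<longleftrightarrow> (\<forall>x\<in>X. g (b x) = f x)" for g
    using assms by (auto simp: bij_betw_def)
  then show ?thesis by (simp add: transport_def)
qed

lemma transport_mono:
  "A \<subseteq> B \<Longrightarrow> transport X Y b A \<subseteq> transport X Y b B"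
  by (auto simp: transport_def)

lemma transport_inv_transport:
  assumes "bij_betw b X Y" and "U \<subseteq> vectors_on X"
  shows "transport Y X (inv_into X b) (transport X Y b U) \<subseteq> U"
proof
  fix f assume "f \<in> transport Y X (inv_into X b) (transport X Y b U)"
  then obtain g h where "f \<in> vectors_on X" "\<forall>x\<in>X. g (b x) = f x"
      "h \<in> U" "\<forall>x\<in>X. g (b x) = h x"
    unfolding transport_inv_iff[OF assms(1)] by (fastforce simp: transport_def[of X Y])
  note fh = this
  have "f = h"
  proof
    fix i show "f i = h i"
      using fh assms(2) by (cases "i \<in> X") (force simp: vectors_on_def)+
  qed
  then show "f \<in> U" using fh by simp
qed

lemma subspace_on_transport:
  assumes "subspace_on X U"
  shows "subspace_on Y (transport X Y b U)"
proof -
  have U: "0 \<in> U" "\<And>f g. f \<in> U \<Longrightarrow> g \<in> U \<Longrightarrow> f + g \<in> U" "\<And>c f. f \<in> U \<Longrightarrow> vscale c f \<in> U"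
    using assms by (auto simp: subspace_on_def vec.subspace_def)
  have "vec.subspace (transport X Y b U)"
  proof (rule vec.subspaceI)
    show "0 \<in> transport X Y b U"
      using U(1) by (auto simp: transport_def vectors_on_def intro!: bexI[where x = 0])
    fix f g assume "f \<in> transport X Y b U" "g \<in> transport X Y b U"
    then obtain f' g' where "f' \<in> U" "g' \<in> U" "\<forall>x\<in>X. f (b x) = f' x" "\<forall>x\<in>X. g (b x) = g' x"
        "f \<in> vectors_on Y" "g \<in> vectors_on Y"
      by (auto simp: transport_def)
    then show "f + g \<in> transport X Y b U"
      using U(2) by (auto simp: transport_def vectors_on_def intro!: bexI[where x = "f' + g'"])
  next
    fix c f assume "f \<in> transport X Y b U"
    then obtain f' where "f' \<in> U" "\<forall>x\<in>X. f (b x) = f' x" "f \<in> vectors_on Y"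
      by (auto simp: transport_def)
    then show "vscale c f \<in> transport X Y b U"
      using U(3)
      by (auto simp: transport_def vectors_on_def vscale_def intro!: bexI[where x = "vscale c f'"])
  qed
  then show ?thesis by (simp add: subspace_on_def transport_subset_vectors_on)
qed

lemma subspace_on_mono: "subspace_on X A \<Longrightarrow> X \<subseteq> Y \<Longrightarrow> subspace_on Y A"
  unfolding subspace_on_def using vectors_on_mono by blast

lemma restriction_extension:
  assumes "X \<inter> Y = {}" and "V \<subseteq> vectors_on (X \<union> Y)"
    and "subspace_on X A" and "subspace_on Y B"
  shows "restriction X Y (V + (A + B)) = restriction X Y V + A"
proof -
  have AB: "A \<subseteq> vectors_on X" "B \<subseteq> vectors_on Y" "0 \<in> B"
    using assms(3,4) by (auto simp: subspace_on_def vec.subspace_def)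
  have "V + (A + B) \<subseteq> vectors_on (X \<union> Y)"
    using assms(2) AB by (fastforce simp: vectors_on_def elim!: set_plus_elim)
  then have "restriction X Y (V + (A + B)) = truncate X ` (V + (A + B))"
    by (rule restriction_eq)
  moreover have tr: "truncate X (v + (a + b)) = truncate X v + a" if "a \<in> A" "b \<in> B" for v a b
  proof -
    have "truncate X a = a" "truncate X b = 0"
      using that AB assms(1) truncate_id truncate_zero by blast+
    then show ?thesis by (simp add: truncate_add)
  qed
  moreover have "truncate X ` (V + (A + B)) = truncate X ` V + A"
  proof
    show "truncate X ` (V + (A + B)) \<subseteq> truncate X ` V + A"
      using tr by (auto elim!: set_plus_elim intro!: set_plus_intro)
    show "truncate X ` V + A \<subseteq> truncate X ` (V + (A + B))"
    proof
      fix f assume "f \<in> truncate X ` V + A"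
      then obtain v a where "v \<in> V" "a \<in> A" "f = truncate X v + a"
        by (auto elim!: set_plus_elim)
      then have "f = truncate X (v + (a + 0))" "v + (a + 0) \<in> V + (A + B)"
        using tr AB(3) by (metis, blast intro: set_plus_intro)
      then show "f \<in> truncate X ` (V + (A + B))" by blast
    qed
  qed
  ultimately show ?thesis
    using assms(2) by (simp add: restriction_eq)
qed

text \<open>Being supported in \<open>Y\<close>, a vector \<open>v + (u + u')\<close> has \<open>X\<close>-part \<open>0\<close>, which forces the \<open>X\<close>-part
  of \<open>v\<close> to be \<open>-u\<close>. This lies in \<open>U\<close>, so the hypothesis on \<open>matched\<close> puts the \<open>Y\<close>-part of \<open>v\<close>
  into \<open>U'\<close>.\<close>

lemma contraction_extension_subset:
  assumes "X \<inter> Y = {}" and "V \<subseteq> vectors_on (X \<union> Y)"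
    and "subspace_on X U" and "subspace_on Y U'"
    and "matched Y X V U \<subseteq> U'"
  shows "contraction Y X (V + (U + U')) \<subseteq> U'"
proof
  fix f assume "f \<in> contraction Y X (V + (U + U'))"
  then obtain v u u' where f: "f = v + (u + u')" "f \<in> vectors_on Y"
      and mem: "v \<in> V" "u \<in> U" "u' \<in> U'"
    by (auto simp: contraction_eq elim!: set_plus_elim)
  have on: "u \<in> vectors_on X" "u' \<in> vectors_on Y" "v \<in> vectors_on (Y \<union> X)"
    using mem assms(2-4) by (auto simp: subspace_on_def Un_commute)
  have "0 = truncate X v + u"
    using f(2) assms(1) on truncate_zero[of f Y X] truncate_zero[of u' Y X] truncate_id[of u X]
    by (simp add: f(1) truncate_add)
  then have "truncate X v = - u"
    by (simp add: eq_neg_iff_add_eq_0)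
  then have "truncate X v \<in> U"
    using mem(2) assms(3) vec.subspace_neg by (auto simp: subspace_on_def)
  then have "truncate Y v \<in> U'"
    using truncate_in_matched[OF mem(1) on(3)] assms(5) by blast
  moreover have "f = truncate Y v + u'"
    using f(2) assms(1) on truncate_id[of f Y] truncate_id[of u' Y] truncate_zero[of u X Y]
    by (simp add: f(1) truncate_add Int_commute)
  ultimately show "f \<in> U'"
    using mem(3) assms(4) vec.subspace_add by (auto simp: subspace_on_def)
qed

lemma transport_inv_set_plus_subset:
  assumes "bij_betw b X Y"
  shows "transport Y X (inv_into X b) (R + S)
    \<subseteq> transport Y X (inv_into X b) R
      + transport Y X (inv_into X b) S"
proof
  fix f assume "f \<in> transport Y X (inv_into X b) (R + S)"
  then obtain r g where f: "f \<in> vectors_on X" "\<forall>x\<in>X. r (b x) + g (b x) = f x"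
      and mem: "r \<in> R" "g \<in> S"
    by (auto simp: transport_inv_iff[OF assms] elim!: set_plus_elim)
  have "truncate X (r \<circ> b) \<in> transport Y X (inv_into X b) R"
    "truncate X (g \<circ> b) \<in> transport Y X (inv_into X b) S"
    using mem unfolding transport_inv_iff[OF assms] by (auto simp: truncate_def vectors_on_def)
  moreover have "f = truncate X (r \<circ> b) + truncate X (g \<circ> b)"
    using f by (auto simp: truncate_def vectors_on_def fun_eq_iff)
  ultimately show "f \<in> transport Y X (inv_into X b) R
      + transport Y X (inv_into X b) S"
    by (metis set_plus_intro)
qed

theorem theorem31:
  fixes W W' :: "'i set" and b :: "'i \<Rightarrow> 'i"
    and V U :: "('i \<Rightarrow> 'a::field) set"
  assumes "finite W" and "W \<inter> W' = {}" and "bij_betw b W W'"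
    and "genaut W W' V"
    and "conditioned_invariant W W' b V U"
  shows "transport W' W (inv_into W b) (contraction W' W V) \<subseteq> U
    \<and> (USG W W' b V \<longrightarrow> genop W W' b (V + direct_sum W W' U (transport W W' b U)))"
proof -
  let ?back = "transport W' W (inv_into W b)"
  define U' where "U' = transport W W' b U"
  define E where "E = V + (U + U')"
  have V: "subspace_on (W \<union> W') V" and Von: "V \<subseteq> vectors_on (W \<union> W')" and V0: "0 \<in> V"
    using assms(4) by (auto simp: genaut_def subspace_on_def vec.subspace_def)
  have U: "subspace_on W U" and Uon: "U \<subseteq> vectors_on W" and U0: "0 \<in> U"
    and inv: "matched W' W V U \<subseteq> U'"
    using assms(5) by (auto simp: conditioned_invariant_def subspace_on_def vec.subspace_def U'_def)
  have U': "subspace_on W' U'" and U'on: "U' \<subseteq> vectors_on W'" and U'0: "0 \<in> U'"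
    using subspace_on_transport[OF U, of W' b]
    by (auto simp: U'_def subspace_on_def vec.subspace_def)
  have E: "V + direct_sum W W' U (transport W W' b U) = E"
    using direct_sum_eq[OF assms(2) Uon U'on] by (simp add: E_def U'_def)
  have back_U': "?back U' \<subseteq> U"
    unfolding U'_def by (rule transport_inv_transport[OF assms(3) Uon])
  have "V \<subseteq> E" "U \<subseteq> E"
    using V0 U0 U'0 set_plus_intro[of _ V _ "U + U'"] set_plus_intro[of _ U _ U']
    unfolding E_def by (metis add.right_neutral add.left_neutral subsetI)+
  have gen: "genaut W W' E"
    unfolding genaut_def E_def using V U U'
    by (intro subspace_on_set_plus) (auto elim: subspace_on_mono)
  have "contraction W' W E \<subseteq> U'"
    unfolding E_def using contraction_extension_subset[OF assms(2) Von U U' inv] .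
  then have backE: "?back (contraction W' W E) \<subseteq> U"
    using transport_mono back_U' by blast
  have "contraction W' W V \<subseteq> contraction W' W E"
    using \<open>V \<subseteq> E\<close> by (auto simp: contraction_eq)
  then have 1: "?back (contraction W' W V) \<subseteq> U"
    using transport_mono backE by blast
  have "LSG W W' b E"
    using gen backE \<open>U \<subseteq> E\<close> Uon by (auto simp: LSG_def contraction_eq[of W])
  moreover have "USG W W' b E" if usg: "USG W W' b V"
  proof -
    have "restriction W' W E = restriction W' W V + U'"
      using restriction_extension[of W' W V U' U] assms(2) Von U U'
      by (simp add: E_def Int_commute Un_commute add.commute[of U U'])
    then have "?back (restriction W' W E) \<subseteq> ?back (restriction W' W V) + ?back U'"
      using transport_inv_set_plus_subset[OF assms(3)] by (simp add: U'_def)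
    also have "\<dots> \<subseteq> restriction W W' V + U"
      using usg back_U' by (intro set_plus_mono2) (auto simp: USG_def)
    also have "\<dots> = restriction W W' E"
      unfolding E_def using restriction_extension[OF assms(2) Von U U'] by simp
    finally show ?thesis using gen by (simp add: USG_def)
  qed
  ultimately show ?thesis
    using 1 by (simp add: E genop_def)
qed

end
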